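(* Let $\Bbbk$ be an algebraically closed field of characteristic zero and let $\mathcal{V}$ be the Virasoro algebra over $\Bbbk$. Let $M$ be a simple weight $\mathcal{V}$-module. Assume that there exists $\lambda\in\Bbbk$ such that $\dim M_{\lambda}=\infty$. Then $\mathrm{supp}(M)=\lambda+\mathbb{Z}$ and for every $k\in\mathbb{Z}$ we have $\dim M_{\lambda+k}=\infty$.
   Context: The Virasoro algebra $\mathcal{V}$ over $\Bbbk$ has basis consisting of a central element $c$ and elements $e_i$, $i\in\mathbb{Z}$, with bracket $[e_i,e_j]=(j-i)e_{i+j}+\delta_{i,-j}\frac{i^3-i}{12}c$. Its Cartan subalgebra is the span of $c$ and $e_0$. A weight $\mathcal{V}$-module is a module on which $e_0$ and $c$ act diagonalizably; for $\lambda\in\Bbbk$, $M_\lambda=\{m\in M: e_0m=\lambda m\}$ is the weight space, and $M=\bigoplus_{\lambda\in\Bbbk}M_\lambda$. The support $\mathrm{supp}(M)$ is the set of $\lambda\in\Bbbk$ with $M_\lambda\neq 0$. *)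

theory Defs
  imports "HOL-Computational_Algebra.Polynomial"
begin

definition alg_closed :: "'k::field itself \<Rightarrow> bool" where
  "alg_closed _ \<longleftrightarrow> (\<forall>p::'k poly. 0 < degree p \<longrightarrow> (\<exists>x. poly p x = 0))"

text \<open>A module over the Virasoro algebra on the vector space (type 'm, scalar
  multiplication scale): E i is the action of e_i, C the action of the central
  element c. Since c and the e_i form a basis of the Virasoro algebra, a module
  structure is exactly given by linear maps satisfying the bracket relations.\<close>
definition vir_module ::
  "('k::field_char_0 \<Rightarrow> 'm::ab_group_add \<Rightarrow> 'm) \<Rightarrow> (int \<Rightarrow> 'm \<Rightarrow> 'm) \<Rightarrow> ('m \<Rightarrow> 'm) \<Rightarrow> bool" where
  "vir_module scale E C \<longleftrightarrow>
     vector_space scale \<and>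
     (\<forall>i. Vector_Spaces.linear scale scale (E i)) \<and>
     Vector_Spaces.linear scale scale C \<and>
     (\<forall>i m. C (E i m) - E i (C m) = 0) \<and>
     (\<forall>i j m. E i (E j m) - E j (E i m) =
        scale (of_int (j - i)) (E (i + j) m) +
        (if i = - j then scale (of_int (i ^ 3 - i) / 12) (C m) else 0))"

definition weight_space :: "('k::field \<Rightarrow> 'm \<Rightarrow> 'm) \<Rightarrow> (int \<Rightarrow> 'm \<Rightarrow> 'm) \<Rightarrow> 'k \<Rightarrow> 'm set" where
  "weight_space scale E w = {m. E 0 m = scale w m}"

definition vir_weight_module ::
  "('k::field_char_0 \<Rightarrow> 'm::ab_group_add \<Rightarrow> 'm) \<Rightarrow> (int \<Rightarrow> 'm \<Rightarrow> 'm) \<Rightarrow> ('m \<Rightarrow> 'm) \<Rightarrow> bool" where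
  "vir_weight_module scale E C \<longleftrightarrow>
     vir_module scale E C \<and>
     module.span scale {m. \<exists>w. E 0 m = scale w m} = UNIV \<and>
     module.span scale {m. \<exists>\<mu>. C m = scale \<mu> m} = UNIV"

definition vir_submodule ::
  "('k::field \<Rightarrow> 'm::ab_group_add \<Rightarrow> 'm) \<Rightarrow> (int \<Rightarrow> 'm \<Rightarrow> 'm) \<Rightarrow> ('m \<Rightarrow> 'm) \<Rightarrow> 'm set \<Rightarrow> bool" where
  "vir_submodule scale E C N \<longleftrightarrow>
     module.subspace scale N \<and> (\<forall>i. \<forall>m\<in>N. E i m \<in> N) \<and> (\<forall>m\<in>N. C m \<in> N)"

definition vir_simple ::
  "('k::field_char_0 \<Rightarrow> 'm::ab_group_add \<Rightarrow> 'm) \<Rightarrow> (int \<Rightarrow> 'm \<Rightarrow> 'm) \<Rightarrow> ('m \<Rightarrow> 'm) \<Rightarrow> bool" where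
  "vir_simple scale E C \<longleftrightarrow>
     vir_module scale E C \<and> (\<exists>m::'m. m \<noteq> 0) \<and>
     (\<forall>N. vir_submodule scale E C N \<longrightarrow> N = {0} \<or> N = UNIV)"

definition supp :: "('k::field \<Rightarrow> 'm::zero \<Rightarrow> 'm) \<Rightarrow> (int \<Rightarrow> 'm \<Rightarrow> 'm) \<Rightarrow> 'k set" where
  "supp scale E = {w. \<exists>m. m \<noteq> 0 \<and> E 0 m = scale w m}"

definition fin_dim :: "('k::field \<Rightarrow> 'm::ab_group_add \<Rightarrow> 'm) \<Rightarrow> 'm set \<Rightarrow> bool" where
  "fin_dim scale S \<longleftrightarrow> (\<exists>B. finite B \<and> B \<subseteq> S \<and> module.span scale B = S)"

end

theory Submission
  imports Defs
begin

text \<open>By simplicity a nonzero weight vector killed by \<open>e\<^sub>1, e\<^sub>2\<close> (or by \<open>e\<^sub>-\<^sub>1, e\<^sub>-\<^sub>2\<close>) makes all weight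
  spaces finite dimensional, so no such vector exists in \<open>M\<close>. If two weights of \<open>\<lambda> + \<int>\<close> have finite
  dimensional weight spaces, intersecting kernels of maps into these spaces produces such a vector.
  Suppose exactly one weight \<open>\<mu>\<close> is finite dimensional. The kernels of finitely many maps
  \<open>M\<^sub>\<mu>\<^sub>-\<^sub>1 \<rightarrow> M\<^sub>\<mu>\<close> contain a common \<open>v \<noteq> 0\<close> with \<open>e\<^sub>1 v = e\<^sub>-\<^sub>1 e\<^sub>2 v = e\<^sub>-\<^sub>2 e\<^sub>3 v = 0\<close>. The brackets
  \<open>[e\<^sub>2, e\<^sub>k]\<close> applied to \<open>e\<^sub>-\<^sub>1 v\<close> determine all \<open>e\<^sub>2 e\<^sub>k v\<close> and force \<open>\<mu> \<in> {0, 1}\<close>; together with the mirror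
  image under \<open>e\<^sub>i \<mapsto> -e\<^sub>-\<^sub>i\<close> this gives \<open>\<mu> = 0\<close>. Then \<open>M\<close> is spanned by the \<open>e\<^sub>k v\<close> and \<open>e\<^sub>-\<^sub>k e\<^sub>2 v\<close> with
  \<open>k \<ge> 2\<close>, like the simple quotient of functions by constants, so its weight spaces are at most
  one-dimensional.\<close>

text \<open>The scalar \<open>\<kappa>\<close> is the action of \<open>c\<close>: its eigenspaces are submodules, so \<open>c\<close> acts by a scalar on a
  simple module.\<close>

locale virasoro_rep = vector_space scale
  for scale :: "'k::field_char_0 \<Rightarrow> 'm::ab_group_add \<Rightarrow> 'm" (infixr \<open>*s\<close> 75) +
  fixes E :: "int \<Rightarrow> 'm \<Rightarrow> 'm" and \<kappa> :: 'k
  assumes linear_E: "Vector_Spaces.linear scale scale (E i)"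
    and bracket: "E i (E j m) - E j (E i m) = of_int (j - i) *s E (i + j) m +
      (if i = - j then (of_int (i ^ 3 - i) / 12 * \<kappa>) *s m else 0)"
begin

abbreviation W :: "'k \<Rightarrow> 'm set" where "W \<equiv> weight_space scale E"

section \<open>Linearity and weights\<close>

lemma E_hom: "module_hom scale scale (E i)"
  using linear_E by (simp add: Vector_Spaces.linear_def)

lemma E_add [simp]: "E i (x + y) = E i x + E i y"
  using E_hom by (rule module_hom.add)

lemma E_scale [simp]: "E i (a *s x) = a *s E i x"
  using E_hom by (rule module_hom.scale)

lemma E_zero [simp]: "E i 0 = 0"
  using E_hom by (rule module_hom.zero)

lemma E_neg [simp]: "E i (- x) = - E i x"
  using E_hom by (rule module_hom.neg)

lemma E_diff [simp]: "E i (x - y) = E i x - E i y"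
  using E_hom by (rule module_hom.diff)

lemma commute: "i + j \<noteq> 0 \<Longrightarrow> E i (E j m) = E j (E i m) + of_int (j - i) *s E (i + j) m"
  using bracket[of i j m] by (auto simp: algebra_simps)

lemma mem_W: "m \<in> W x \<longleftrightarrow> E 0 m = x *s m"
  by (simp add: weight_space_def)

lemma subspace_W: "subspace (W x)"
  by (rule subspaceI) (auto simp: mem_W algebra_simps)

lemma E_in_W: "m \<in> W x \<Longrightarrow> E k m \<in> W (x + of_int k)"
  using bracket[of 0 k m] by (auto simp: mem_W algebra_simps split: if_splits)

lemma E_in_W': "m \<in> W x \<Longrightarrow> y = x + of_int k \<Longrightarrow> E k m \<in> W y"
  using E_in_W by blast

section \<open>Finite dimension, kernels and spans of weight vectors\<close>

lemma fin_dim_subspaceI: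
  assumes "subspace S" "finite B" "S \<subseteq> span B"
  shows "fin_dim scale S"
proof -
  obtain B' where B': "B' \<subseteq> S" "independent B'" "S \<subseteq> span B'"
    using maximal_independent_subset by blast
  have "finite B'"
    using independent_span_bound[OF \<open>finite B\<close> B'(2)] B'(1) assms(3) by auto
  moreover have "span B' = S"
    using B' assms(1) span_minimal by blast
  ultimately show ?thesis
    using B'(1) unfolding fin_dim_def by blast
qed

text \<open>Rank-nullity: a finite spanning set of the kernel and preimages of one of the image
  would together span \<open>V\<close>.\<close>

lemma infinite_dim_kernel:
  assumes V: "subspace V" "\<not> fin_dim scale V" and f: "Vector_Spaces.linear scale scale f"
    and U: "fin_dim scale U" "f ` V \<subseteq> U"
  shows "\<not> fin_dim scale {v \<in> V. f v = 0}"
proof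
  interpret f: Vector_Spaces.linear scale scale f by (rule f)
  assume "fin_dim scale {v \<in> V. f v = 0}"
  then obtain A where A: "finite A" "A \<subseteq> V" "span A = {v \<in> V. f v = 0}"
    unfolding fin_dim_def by auto
  obtain B where B: "finite B" "span B = U"
    using U(1) unfolding fin_dim_def by auto
  have "fin_dim scale (f ` V)"
    using fin_dim_subspaceI[OF f.subspace_image[OF V(1)] B(1)] B(2) U(2) by simp
  then obtain D where D: "finite D" "D \<subseteq> f ` V" "span D = f ` V"
    unfolding fin_dim_def by auto
  obtain D' where D': "finite D'" "D' \<subseteq> V" "D = f ` D'"
    using D finite_subset_image by metis
  have "v \<in> span (A \<union> D')" if "v \<in> V" for v
  proof -
    have "f v \<in> f ` span D'"
      using that D(3) D'(3) f.span_image by auto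
    then obtain d where d: "d \<in> span D'" "f v = f d" by auto
    have "d \<in> V" using d(1) D'(2) V(1) span_minimal by blast
    then have "v - d \<in> span A"
      using A(3) that d(2) V(1) by (simp add: f.diff subspace_diff)
    then have "(v - d) + d \<in> span (A \<union> D')"
      using d(1) by (metis span_add span_mono subsetD sup_ge1 sup_ge2)
    then show ?thesis by simp
  qed
  then show False
    using fin_dim_subspaceI[OF V(1), of "A \<union> D'"] V(2) A(1) D'(1) by blast
qed

lemma infinite_dim_nonzero:
  assumes "\<not> fin_dim scale V" "subspace V"
  obtains v where "v \<in> V" "v \<noteq> 0"
  using assms fin_dim_subspaceI[of V "{}"] by auto

lemma span_finite_supportE:
  assumes "m \<in> span B"
  obtains T where "finite T" "T \<subseteq> B" "m \<in> span T"
proof -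
  obtain T r where "finite T" "T \<subseteq> B" "m = (\<Sum>a\<in>T. r a *s a)"
    using assms unfolding span_explicit[of B] mem_Collect_eq by metis
  moreover have "(\<Sum>a\<in>T. r a *s a) \<in> span T"
    by (intro span_sum span_scale span_base)
  ultimately show ?thesis using that by blast
qed

text \<open>Eigenspaces of \<open>E 0\<close> are independent, so generators of other weights
  contribute nothing to a vector of weight \<open>x\<close>.\<close>

lemma weight_space_subset_span:
  assumes wt: "\<And>i. i \<in> I \<Longrightarrow> f i \<in> W (wt i)" and gen: "span (f ` I) = UNIV"
  shows "W x \<subseteq> span (f ` {i \<in> I. wt i = x})"
proof
  fix m assume m: "m \<in> W x"
  have step: "finite S \<Longrightarrow> x \<notin> S \<Longrightarrow> m \<in> span (f ` {i \<in> I. wt i \<in> insert x S}) \<Longrightarrow>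
      m \<in> span (f ` {i \<in> I. wt i = x})" for S
  proof (induction S rule: finite_induct)
    case empty
    then show ?case by simp
  next
    case (insert s S)
    \<comment> \<open>The operator \<open>e\<^sub>0 - s\<close> removes the weight \<open>s\<close> and only rescales \<open>m\<close>.\<close>
    let ?B = "\<lambda>S. f ` {i \<in> I. wt i \<in> S}"
    have "E 0 y - s *s y \<in> span (?B (insert x S))" if "y \<in> span (?B (insert x (insert s S)))" for y
      using that
    proof (rule span_induct)
      show "subspace {y. E 0 y - s *s y \<in> span (?B (insert x S))}"
      proof (rule subspaceI)
        fix a b assume "a \<in> {y. E 0 y - s *s y \<in> span (?B (insert x S))}"
          "b \<in> {y. E 0 y - s *s y \<in> span (?B (insert x S))}"
        then have "(E 0 a - s *s a) + (E 0 b - s *s b) \<in> span (?B (insert x S))"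
          using span_add by blast
        then show "a + b \<in> {y. E 0 y - s *s y \<in> span (?B (insert x S))}"
          by (simp add: algebra_simps)
      next
        fix c a assume "a \<in> {y. E 0 y - s *s y \<in> span (?B (insert x S))}"
        then have "c *s (E 0 a - s *s a) \<in> span (?B (insert x S))"
          using span_scale by blast
        then show "c *s a \<in> {y. E 0 y - s *s y \<in> span (?B (insert x S))}"
          by (simp add: algebra_simps)
      qed (simp add: span_zero)
    next
      fix b assume "b \<in> ?B (insert x (insert s S))"
      then obtain i where i: "i \<in> I" "b = f i" "wt i \<in> insert x (insert s S)" by auto
      have eq: "E 0 b - s *s b = (wt i - s) *s b"
        using wt[OF i(1)] i(2) by (simp add: mem_W algebra_simps)
      show "E 0 b - s *s b \<in> span (?B (insert x S))"
      proof (cases "wt i = s")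
        case True
        then show ?thesis using eq by (simp add: span_zero)
      next
        case False
        then have "b \<in> ?B (insert x S)" using i by auto
        then show ?thesis unfolding eq by (intro span_scale span_base)
      qed
    qed
    from this[OF insert.prems(2)] have "(x - s) *s m \<in> span (?B (insert x S))"
      using m by (simp add: mem_W algebra_simps)
    then have "inverse (x - s) *s (x - s) *s m \<in> span (?B (insert x S))"
      by (rule span_scale)
    then show ?case using insert by simp
  qed
  have "m \<in> span (f ` I)" using gen by simp
  then obtain T where T: "finite T" "T \<subseteq> f ` I" "m \<in> span T"
    by (rule span_finite_supportE)
  obtain J where J: "finite J" "J \<subseteq> I" "T = f ` J"
    using finite_subset_image[OF T(1,2)] by blast
  have "T \<subseteq> f ` {i \<in> I. wt i \<in> insert x (wt ` J - {x})}"
    using J by auto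
  then show "m \<in> span (f ` {i \<in> I. wt i = x})"
    using T(3) J(1) by (intro step[of "wt ` J - {x}"]) (auto dest: span_mono)
qed

lemma fin_dim_weight_spaceI:
  assumes "\<And>i. i \<in> I \<Longrightarrow> f i \<in> W (wt i)" "span (f ` I) = UNIV"
    and "finite {i \<in> I. wt i = x}"
  shows "fin_dim scale (W x)"
  using fin_dim_subspaceI[OF subspace_W _ weight_space_subset_span[OF assms(1,2)]] assms(3) by blast

section \<open>Generation by the elements of degree 1, 2, -1 and -2\<close>

text \<open>In [e_1, e_k] = (k - 1) e_{k+1} the factor is nonzero for k >= 2, so annihilation passes
  from k to k + 1.\<close>

lemma annihilated_upward:
  assumes "E 1 v = 0" "E j v = 0" "j \<ge> 2" "k \<ge> j"
  shows "E k v = 0"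
  using assms(4)
proof (induction k rule: int_ge_induct)
  case base
  then show ?case by (rule assms(2))
next
  case (step k)
  have "of_int (k - 1) *s E (1 + k) v = 0"
    using commute[of 1 k v] step assms by simp
  then have "(of_int (k - 1) :: 'k) = 0 \<or> E (1 + k) v = 0" by (simp only: scale_eq_0_iff)
  then show ?case using step assms by (simp add: add.commute)
qed

text \<open>By the same bracket, e_1 and e_2 generate all e_k with k >= 1.\<close>

lemma closed_upward:
  assumes N: "subspace N" "\<And>m. m \<in> N \<Longrightarrow> E 1 m \<in> N" "\<And>m. m \<in> N \<Longrightarrow> E 2 m \<in> N"
    and "k \<ge> 1" "m \<in> N"
  shows "E k m \<in> N"
proof (cases "k = 1")
  case False
  then have "k \<ge> 2" using \<open>k \<ge> 1\<close> by simp
  then show ?thesis using \<open>m \<in> N\<close>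
  proof (induction k arbitrary: m rule: int_ge_induct)
    case base
    then show ?case by (rule N(3))
  next
    case (step k)
    have "E 1 (E k m) - E k (E 1 m) \<in> N"
      using step N by (intro subspace_diff) auto
    then have "of_int (k - 1) *s E (1 + k) m \<in> N"
      using commute[of 1 k m] step(1) by simp
    then have "inverse (of_int (k - 1)) *s of_int (k - 1) *s E (1 + k) m \<in> N"
      by (rule subspace_scale[OF N(1)])
    moreover have "(of_int (k - 1) :: 'k) \<noteq> 0" using step(1) by (simp only: of_int_eq_0_iff)
    ultimately show ?case by (simp add: add.commute[of k] del: of_int_diff)
  qed
qed (use assms in auto)

text \<open>e_i -> -e_{-i}, c -> -c is an automorphism of the Virasoro algebra. Interpreting the
  locale for the twisted module yields mirror images of results, with weights negated.\<close>

lemma reflected: "virasoro_rep scale (\<lambda>i m. - E (- i) m) (- \<kappa>)"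
proof (intro virasoro_rep.intro virasoro_rep_axioms.intro vector_space_axioms, goal_cases)
  case (1 i)
  show "Vector_Spaces.linear scale scale (\<lambda>m. - E (- i) m)"
    using linear_E by (simp add: Vector_Spaces.linear_iff)
next
  case (2 i j m)
  show "- E (- i) (- E (- j) m) - - E (- j) (- E (- i) m) = of_int (j - i) *s - E (- (i + j)) m +
      (if i = - j then (of_int (i ^ 3 - i) / 12 * - \<kappa>) *s m else 0)"
    using bracket[of "- i" "- j" m]
    by (auto simp: algebra_simps minus_divide_left power3_eq_cube)
qed

text \<open>Negative degrees mirror the positive ones, and [e_{-1}, e_1] = 2 e_0 without central
  term.\<close>

lemma closed_all:
  assumes N: "subspace N" "\<And>m. m \<in> N \<Longrightarrow> E 1 m \<in> N" "\<And>m. m \<in> N \<Longrightarrow> E 2 m \<in> N"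
    "\<And>m. m \<in> N \<Longrightarrow> E (- 1) m \<in> N" "\<And>m. m \<in> N \<Longrightarrow> E (- 2) m \<in> N" "m \<in> N"
  shows "E k m \<in> N"
proof -
  interpret R: virasoro_rep scale "\<lambda>i m. - E (- i) m" "- \<kappa>" by (rule reflected)
  consider "k \<ge> 1" | "- k \<ge> 1" | "k = 0" by linarith
  then show ?thesis
  proof cases
    case 1
    then show ?thesis using closed_upward N by blast
  next
    case 2
    have "- E (- 1) m \<in> N" "- E (- 2) m \<in> N" if "m \<in> N" for m
      using subspace_neg[OF N(1)] N(4,5) that by auto
    then have "- E (- (- k)) m \<in> N"
      using R.closed_upward[OF N(1), of "- k" m] N(6) 2 by blast
    then have "- (- E (- (- k)) m) \<in> N" by (rule subspace_neg[OF N(1)])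
    then show ?thesis by simp
  next
    case 3
    have "E (- 1) (E 1 m) - E 1 (E (- 1) m) \<in> N"
      using N by (intro subspace_diff) auto
    then have "2 *s E 0 m \<in> N"
      using bracket[of "- 1" 1 m] by simp
    then have "inverse 2 *s 2 *s E 0 m \<in> N"
      by (rule subspace_scale[OF N(1)])
    then show ?thesis using 3 by simp
  qed
qed

lemma scale_left_cancel_of_int: "k \<noteq> 0 \<Longrightarrow> of_int k *s x = of_int k *s y \<Longrightarrow> x = y"
  by simp

section \<open>Vectors of weight \<mu> - 1 killed by e_1 and e_{-1} e_2\<close>

context
  fixes v \<mu>
  assumes v_W: "v \<in> W (\<mu> - 1)" and E1_v: "E 1 v = 0" and Em1_E2_v: "E (- 1) (E 2 v) = 0"
begin

lemma E1_E: "k \<noteq> - 1 \<Longrightarrow> E 1 (E k v) = of_int (k - 1) *s E (k + 1) v"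
  using commute[of 1 k v] E1_v by (simp add: add.commute)

lemma E0_E: "E 0 (E k v) = (\<mu> - 1 + of_int k) *s E k v"
  using E_in_W[OF v_W, of k] by (simp add: mem_W)

text \<open>\<open>E (k + 1) v\<close> is a multiple of \<open>E 1 (E k v)\<close>, so moving
  \<open>E (- 1)\<close> past \<open>E 1\<close> gives an induction, started by
  \<open>Em1_E2_v\<close>.\<close>

lemma Em1_E: "k \<ge> 3 \<Longrightarrow> E (- 1) (E k v) = (2 * \<mu> + of_int k - 1) *s E (k - 1) v"
proof (induction k rule: int_ge_induct)
  case base
  have "E (- 1) (E 1 (E 2 v)) = 2 *s E 0 (E 2 v)"
    using bracket[of "- 1" 1 "E 2 v"] Em1_E2_v by simp
  then show ?case by (simp add: E1_E E0_E algebra_simps)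
next
  case (step k)
  have "E (- 1) (E 1 (E k v)) = E 1 (E (- 1) (E k v)) + 2 *s E 0 (E k v)"
    using bracket[of "- 1" 1 "E k v"] by (simp add: algebra_simps)
  also have "\<dots> = ((2 * \<mu> + of_int k - 1) * of_int (k - 2) + 2 * (\<mu> - 1 + of_int k)) *s E k v"
    using step E1_E[of "k - 1"] by (simp add: E0_E flip: scale_left_distrib)
  also have "(2 * \<mu> + of_int k - 1) * of_int (k - 2) + 2 * (\<mu> - 1 + of_int k) =
      of_int (k - 1) * (2 * \<mu> + of_int (k + 1) - 1)"
    by (simp add: algebra_simps)
  finally have "of_int (k - 1) *s E (- 1) (E (k + 1) v) =
      of_int (k - 1) *s (2 * \<mu> + of_int (k + 1) - 1) *s E k v"
    using E1_E[of k] step(1) by simp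
  then have "E (- 1) (E (k + 1) v) = (2 * \<mu> + of_int (k + 1) - 1) *s E k v"
    by (rule scale_left_cancel_of_int[rotated]) (use step(1) in simp)
  then show ?case by simp
qed

lemma E_Em1:
  assumes "k \<ge> 3"
  shows "E k (E (- 1) v) = (2 * \<mu> - 2) *s E (k - 1) v"
proof -
  have "E k (E (- 1) v) = (2 * \<mu> + of_int k - 1 + of_int (- 1 - k)) *s E (k - 1) v"
    using commute[of k "- 1" v] Em1_E[OF assms] assms by (simp only: scale_left_distrib) simp
  then show ?thesis by simp
qed

text \<open>\<open>E 2\<close> kills \<open>E (- 1) v\<close>, and by \<open>E_Em1\<close> the
  operators of degree at least 3 act on it with the common factor \<open>2 * \<mu> - 2\<close>.
  Evaluate [e_2, e_{k+1}] there and cancel this factor, nonzero for \<mu> \<noteq> 1.\<close>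

lemma E2_E:
  assumes "\<mu> \<noteq> 1" "k \<ge> 2"
  shows "E 2 (E k v) = of_int (k - 1) *s E (k + 2) v"
proof -
  have E2: "E 2 (E (- 1) v) = 0"
    using commute[of 2 "- 1" v] E1_v Em1_E2_v by simp
  have "E 2 (E (k + 1) (E (- 1) v)) = of_int (k - 1) *s E (k + 3) (E (- 1) v)"
    using commute[of 2 "k + 1" "E (- 1) v"] assms(2) E2 by (simp add: algebra_simps)
  then have "(2 * \<mu> - 2) *s E 2 (E k v) = (2 * \<mu> - 2) *s of_int (k - 1) *s E (k + 2) v"
    using E_Em1[of "k + 1"] E_Em1[of "k + 3"] assms(2) by (simp add: mult.commute add.commute[of 2 k])
  moreover have "2 * \<mu> - 2 \<noteq> 0" using assms(1) by simp
  ultimately show ?thesis by (simp only: scale_cancel_left) simp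
qed

end

text \<open>The case \<mu> = 0, by a similar induction with [e_{-2}, e_1] = 3 e_{-1}.\<close>

lemma Em2_E:
  assumes v: "v \<in> W (- 1)" "E 1 v = 0" "E (- 1) (E 2 v) = 0" "E (- 2) (E 3 v) = 0" and "k \<ge> 4"
  shows "E (- 2) (E k v) = of_int (k - 1) *s E (k - 2) v"
proof -
  have "v \<in> W (0 - 1)" using v(1) by simp
  note E1_E = E1_E[OF this v(2,3)] and Em1_E = Em1_E[OF this v(2,3)]
  show ?thesis using \<open>k \<ge> 4\<close>
  proof (induction k rule: int_ge_induct)
    case base
    have "E (- 2) (E 1 (E 3 v)) = 3 *s E (- 1) (E 3 v)"
      using commute[of "- 2" 1 "E 3 v"] v(4) by simp
    then have "2 *s E (- 2) (E 4 v) = 2 *s 3 *s E 2 v"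
      using E1_E[of 3] Em1_E[of 3] by simp
    then show ?case by (simp only: scale_cancel_left) simp
  next
    case (step k)
    have "of_int (k - 1) *s E (- 2) (E (k + 1) v) = E (- 2) (E 1 (E k v))"
      using E1_E[of k] step(1) by simp
    also have "\<dots> = E 1 (E (- 2) (E k v)) + 3 *s E (- 1) (E k v)"
      using commute[of "- 2" 1 "E k v"] by simp
    also have "\<dots> = (of_int (k - 1) * of_int (k - 3) + 3 * of_int (k - 1)) *s E (k - 1) v"
      using step E1_E[of "k - 2"] Em1_E[of k] by (simp flip: scale_left_distrib)
    also have "of_int (k - 1) * of_int (k - 3) + 3 * of_int (k - 1) = of_int (k - 1) * (of_int k :: 'k)"
      by (simp add: algebra_simps)
    also have "(of_int (k - 1) * of_int k) *s E (k - 1) v = of_int (k - 1) *s of_int k *s E (k - 1) v"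
      by simp
    finally have "E (- 2) (E (k + 1) v) = of_int k *s E (k - 1) v"
      by (rule scale_left_cancel_of_int[rotated]) (use step(1) in simp)
    then show ?case by simp
  qed
qed

text \<open>Tests the degrees that \<open>closed_all\<close> requires.
  \<open>E (- 2) (E 2 v)\<close> has weight -1, outside the weights of the \<open>E k v\<close>, so
  its membership is a hypothesis. Serves for \<open>v\<close> and, after reflection, for
  \<open>E 2 v\<close>.\<close>

lemma upper_half_closed:
  assumes v: "v \<in> W (- 1)" "E 1 v = 0" "E (- 1) (E 2 v) = 0" "E (- 2) (E 3 v) = 0"
    and N: "subspace N" "E (- 2) (E 2 v) \<in> N" "\<And>k. k \<ge> 2 \<Longrightarrow> E k v \<in> N"
    and k: "k \<ge> 2" and j: "j \<in> {1, 2, - 1, - 2}"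
  shows "E j (E k v) \<in> N"
proof -
  have "v \<in> W (0 - 1)" using v(1) by simp
  note E1_E = E1_E[OF this v(2,3)] and Em1_E = Em1_E[OF this v(2,3)] and E2_E = E2_E[OF this v(2,3)]
  consider "k = 2" | "k = 3" | "k \<ge> 4" using k by linarith
  then have "E (- 2) (E k v) \<in> N"
    using N v(4) Em2_E[OF v, of k] subspace_0[OF N(1)] by cases (auto intro!: subspace_scale[OF N(1)])
  moreover have "k = 2 \<or> k \<ge> 3" using k by linarith
  then have "E (- 1) (E k v) \<in> N"
    using N v(3) Em1_E[of k] subspace_0[OF N(1)] by (auto intro!: subspace_scale[OF N(1)])
  ultimately show ?thesis
    using j k E1_E[of k] E2_E[of k] N(3)[of "k + 1"] N(3)[of "k + 2"] subspace_scale[OF N(1)] by auto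
qed

end

section \<open>Highest and lowest weight vectors in a simple module\<close>

locale simple_virasoro_rep = virasoro_rep +
  assumes irreducible: "subspace N \<Longrightarrow> (\<And>i m. m \<in> N \<Longrightarrow> E i m \<in> N) \<Longrightarrow> N = {0} \<or> N = UNIV"
begin

lemma reflected_simple: "simple_virasoro_rep scale (\<lambda>i m. - E (- i) m) (- \<kappa>)"
proof (intro simple_virasoro_rep.intro simple_virasoro_rep_axioms.intro reflected)
  fix N assume N: "subspace N" "\<And>i m. m \<in> N \<Longrightarrow> - E (- i) m \<in> N"
  have "E i m \<in> N" if "m \<in> N" for i m
    using subspace_neg[OF N(1) N(2)[OF that, of "- i"]] by simp
  then show "N = {0} \<or> N = UNIV" using irreducible N(1) by blast
qed

lemma weight_space_reflected: "weight_space scale (\<lambda>i m. - E (- i) m) x = W (- x)"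
  by (auto simp: weight_space_def minus_equation_iff[of "E 0 _"])

text \<open>By irreducibility the words of lowering operators applied to \<open>v\<close> span the
  module, and only finitely many words have a given weight.\<close>

lemma fin_dim_of_highest_weight:
  assumes v: "v \<noteq> 0" "v \<in> W \<mu>" and ann: "E 1 v = 0" "E 2 v = 0"
  shows "fin_dim scale (W x)"
proof -
  \<comment> \<open>The letter \<open>j\<close> stands for e_{-(j+1)}, so every letter strictly
    lowers the weight. All orders of letters are allowed, which overcounts a PBW spanning set but
    keeps the count finite.\<close>
  define word where "word L = foldr (\<lambda>j. E (- int (Suc j))) L v" for L
  have word_simps [simp]: "word [] = v" "word (j # L) = E (- int (Suc j)) (word L)" for j L
    by (simp_all add: word_def)
  define wt :: "nat list \<Rightarrow> 'a" where "wt L = \<mu> - of_nat (sum_list (map Suc L))" for L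
  have wt: "word L \<in> W (wt L)" for L
  proof (induction L)
    case Nil
    then show ?case using v by (simp add: wt_def)
  next
    case (Cons j L)
    then show ?case unfolding word_simps by (rule E_in_W') (simp add: wt_def)
  qed
  let ?N = "span (range word)"
  have low: "E (- int (Suc j)) m \<in> ?N" if "m \<in> ?N" for j m
    using that
  proof (rule span_induct)
    show "subspace {m. E (- int (Suc j)) m \<in> ?N}"
      by (rule subspaceI) (auto intro: span_zero span_add span_scale)
    show "E (- int (Suc j)) m \<in> ?N" if "m \<in> range word" for m
      using that by (metis (no_types) imageE rangeI span_base word_simps(2))
  qed
  have v_in: "v \<in> ?N" using span_base[OF rangeI[of word "[]"]] by simp
  have words: "E i (word L) \<in> ?N" for i L
  proof (induction L arbitrary: i)
    case Nil
    consider "i \<ge> 2" | "i = 1" | "i = 0" | j where "i = - int (Suc j)"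
    proof (cases i rule: int_cases)
      case (nonneg n)
      then have "i \<ge> 2 \<or> i = 1 \<or> i = 0" by linarith
      then show ?thesis using that by blast
    qed (use that in blast)
    then show ?case
    proof cases
      case 1
      then show ?thesis using annihilated_upward[OF ann] by (simp add: span_zero)
    next
      case 2
      then show ?thesis using ann by (simp add: span_zero)
    next
      case 3
      then show ?thesis using v v_in by (simp add: mem_W span_scale)
    next
      case 4
      then show ?thesis using low v_in by simp
    qed
  next
    case (Cons j L)
    have "E (- int (Suc j)) (E i (word L)) + (of_int (- int (Suc j) - i) *s E (i + - int (Suc j)) (word L)
      + (if i = - (- int (Suc j)) then (of_int (i ^ 3 - i) / 12 * \<kappa>) *s word L else 0)) \<in> ?N"
      by (intro span_add low Cons) (auto intro: span_scale span_zero span_base Cons)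
    then show ?case
      unfolding word_simps using bracket[of i "- int (Suc j)" "word L"]
      by (metis add.commute diff_add_cancel)
  qed
  have "E i m \<in> ?N" if "m \<in> ?N" for i m
    using that
  proof (rule span_induct)
    show "subspace {m. E i m \<in> ?N}"
      by (rule subspaceI) (auto intro: span_zero span_add span_scale)
  qed (use words in auto)
  then have "?N = UNIV" using irreducible[of ?N] v v_in by auto
  moreover have "finite {L \<in> UNIV. wt L = x}"
  proof (cases "\<exists>d::nat. x = \<mu> - of_nat d")
    case True
    then obtain d where d: "x = \<mu> - of_nat d" by blast
    \<comment> \<open>A letter \<open>j\<close> contributes \<open>Suc j\<close> to the total
      \<open>d\<close>, which bounds both the letters and the length.\<close>
    have "set L \<subseteq> {..d} \<and> length L \<le> d" if "wt L = x" for L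
    proof -
      have L: "sum_list (map Suc L) = d"
        using d that by (simp add: wt_def del: of_nat_add of_nat_Suc)
      have "j \<le> d" if "j \<in> set L" for j
        using member_le_sum_list[of "Suc j" "map Suc L"] that L by auto
      moreover have "length L \<le> d" unfolding L[symmetric] by (induction L) auto
      ultimately show ?thesis by auto
    qed
    then have "{L \<in> UNIV. wt L = x} \<subseteq> {L. set L \<subseteq> {..d} \<and> length L \<le> d}" by auto
    then show ?thesis using finite_lists_length_le[of "{..d}" d] finite_subset by auto
  next
    case False
    then have "wt L \<noteq> x" for L unfolding wt_def by blast
    then show ?thesis by simp
  qed
  ultimately show ?thesis using wt by (intro fin_dim_weight_spaceI[of UNIV word wt]) auto
qed

lemma fin_dim_of_lowest_weight:
  assumes "v \<noteq> 0" "v \<in> W \<mu>" and "E (- 1) v = 0" "E (- 2) v = 0"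
  shows "fin_dim scale (W x)"
proof -
  interpret R: simple_virasoro_rep scale "\<lambda>i m. - E (- i) m" "- \<kappa>" by (rule reflected_simple)
  show ?thesis
    using R.fin_dim_of_highest_weight[of v "- \<mu>" "- x"] assms by (simp add: weight_space_reflected)
qed

section \<open>Two finite dimensional weight spaces\<close>

lemma subspace_ker: "subspace V \<Longrightarrow> subspace {v \<in> V. E i v = 0}"
  by (rule subspaceI) (auto intro: subspace_0 subspace_add subspace_scale)

lemma infinite_dim_ker:
  assumes "subspace V" "\<not> fin_dim scale V" "V \<subseteq> W x" "fin_dim scale (W (x + of_int i))"
  shows "\<not> fin_dim scale {v \<in> V. E i v = 0}"
  using infinite_dim_kernel[OF assms(1,2) linear_E assms(4)] assms(3) E_in_W by blast

lemma subspace_ker2: "subspace V \<Longrightarrow> subspace {v \<in> V. E i (E j v) = 0}"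
  by (rule subspaceI) (auto intro: subspace_0 subspace_add subspace_scale)

lemma infinite_dim_ker2:
  assumes "subspace V" "\<not> fin_dim scale V" "V \<subseteq> W x" "fin_dim scale (W (x + of_int (j + i)))"
  shows "\<not> fin_dim scale {v \<in> V. E i (E j v) = 0}"
proof (rule infinite_dim_kernel[OF assms(1,2) _ assms(4)])
  show "Vector_Spaces.linear scale scale (\<lambda>v. E i (E j v))"
    using Vector_Spaces.linear_compose[OF linear_E[of j] linear_E[of i]] by (simp add: o_def)
  show "(\<lambda>v. E i (E j v)) ` V \<subseteq> W (x + of_int (j + i))"
    using assms(3) by (auto intro!: E_in_W' simp: add.assoc)
qed

text \<open>Otherwise e_1, e_j and e_{-1} e_2 have a common kernel vector
  \<open>v \<noteq> 0\<close> in \<open>W x\<close>. Then e_1 and e_2 kill \<open>E 2 v\<close>, so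
  \<open>E 2 v\<close>, or \<open>v\<close> if \<open>E 2 v = 0\<close>, is a highest weight
  vector.\<close>

lemma fin_dim_if_two_above:
  assumes fin: "fin_dim scale (W (x + 1))" "fin_dim scale (W (x + of_int j))" and "j \<ge> 2"
  shows "fin_dim scale (W x)"
proof (rule ccontr)
  assume inf: "\<not> fin_dim scale (W x)"
  define V where "V = {v \<in> {v \<in> {v \<in> W x. E 1 v = 0}. E j v = 0}. E (- 1) (E 2 v) = 0}"
  have "\<not> fin_dim scale V"
    unfolding V_def using fin inf
    by (intro infinite_dim_ker2[where x = x] infinite_dim_ker[where x = x] subspace_ker subspace_W) auto
  then obtain v where "v \<in> V" "v \<noteq> 0"
    by (rule infinite_dim_nonzero) (unfold V_def, intro subspace_ker subspace_ker2 subspace_W)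
  then have v: "v \<noteq> 0" "v \<in> W x" "E 1 v = 0" "E j v = 0" "E (- 1) (E 2 v) = 0"
    by (auto simp: V_def)
  have up: "E k v = 0" if "k \<ge> j" for k
    using annihilated_upward[OF v(3,4) \<open>j \<ge> 2\<close> that] .
  have ann: "E k (E 2 v) = 0" if "k \<ge> j" for k
    using commute[of k 2 v] up[OF that] up[of "k + 2"] that \<open>j \<ge> 2\<close> by simp
  \<comment> \<open>Descent from \<open>j\<close>: since \<open>E (- 1)\<close> kills
    \<open>E 2 v\<close>, the bracket [e_{-1}, e_k] = (k + 1) e_{k-1} carries annihilation from k to
    k - 1.\<close>
  have "E k (E 2 v) = 0" if "k \<le> j" "k \<ge> 1" for k
    using that
  proof (induction k rule: int_le_induct)
    case base
    then show ?case using ann by simp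
  next
    case (step k)
    then have "of_int (k + 1) *s E (- 1 + k) (E 2 v) = 0"
      using commute[of "- 1" k "E 2 v"] v(5) by simp
    then have "(of_int (k + 1) :: 'a) = 0 \<or> E (k - 1) (E 2 v) = 0"
      by (simp add: algebra_simps del: of_int_add)
    then show ?case using step by (simp only: of_int_eq_0_iff) auto
  qed
  then have "E 1 (E 2 v) = 0" "E 2 (E 2 v) = 0" using \<open>j \<ge> 2\<close> by auto
  moreover have "E 2 v \<noteq> 0"
    using fin_dim_of_highest_weight[of v x] v inf by auto
  ultimately show False
    using fin_dim_of_highest_weight[of "E 2 v"] E_in_W[OF v(2)] inf by blast
qed

lemma fin_dim_if_two_below:
  assumes "fin_dim scale (W (x - 1))" "fin_dim scale (W (x - of_int j))" and "j \<ge> 2"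
  shows "fin_dim scale (W x)"
proof -
  interpret R: simple_virasoro_rep scale "\<lambda>i m. - E (- i) m" "- \<kappa>" by (rule reflected_simple)
  show ?thesis
    using R.fin_dim_if_two_above[of "- x" j] assms
    by (simp add: weight_space_reflected algebra_simps)
qed

section \<open>An isolated finite dimensional weight space\<close>

text \<open>For other \<mu>, \<open>E (- 1) (E 2 (E 2 v))\<close> equals
  \<open>(2 * \<mu> + 3) *s E 3 v\<close> via \<open>E 4 v\<close>, and \<open>3 *s E 3 v\<close> by
  commuting. Hence \<open>E 3 v = 0\<close> and \<open>E 2 v\<close> is a highest weight
  vector.\<close>

lemma weight_gap_zero_or_one:
  assumes v: "v \<in> W (\<mu> - 1)" "v \<noteq> 0" "E 1 v = 0" "E (- 1) (E 2 v) = 0"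
    and inf: "\<not> fin_dim scale (W x)"
  shows "\<mu> = 0 \<or> \<mu> = 1"
proof (rule ccontr)
  assume \<mu>: "\<not> (\<mu> = 0 \<or> \<mu> = 1)"
  note str = E1_E[OF v(1,3,4)] Em1_E[OF v(1,3,4)] E2_E[OF v(1,3,4)]
  have E2: "E 2 v \<noteq> 0"
    using fin_dim_of_highest_weight[of v] v inf by blast
  have "E 2 (E 2 v) = E 4 v" using str(3)[of 2] \<mu> by simp
  moreover have "E (- 1) (E 2 (E 2 v)) = 3 *s E 3 v"
    using commute[of "- 1" 2 "E 2 v"] v(4) str(1)[of 2] by simp
  ultimately have "(2 * \<mu>) *s E 3 v = 0"
    using str(2)[of 4] by (simp add: algebra_simps)
  then have E3: "E 3 v = 0" using \<mu> by simp
  then have "E 1 (E 2 v) = 0" "2 *s E 4 v = 0" using str(1)[of 2] str(1)[of 3] by simp_all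
  then have "E 1 (E 2 v) = 0" "E 2 (E 2 v) = 0" using \<open>E 2 (E 2 v) = E 4 v\<close> by simp_all
  then show False
    using fin_dim_of_highest_weight[OF E2] E_in_W[OF v(1)] inf by blast
qed

text \<open>e_1, e_{-1} e_2 and e_{-2} e_3 all have degree 1, so they map
  \<open>W (\<mu> - 1)\<close> into \<open>W \<mu>\<close>.\<close>

lemma weight_gap_vector:
  assumes fin: "fin_dim scale (W \<mu>)" and inf: "\<not> fin_dim scale (W (\<mu> - 1))"
  obtains v where "v \<in> W (\<mu> - 1)" "v \<noteq> 0" "E 1 v = 0" "E (- 1) (E 2 v) = 0" "E (- 2) (E 3 v) = 0"
proof -
  define V where "V = {v \<in> {v \<in> {v \<in> W (\<mu> - 1). E 1 v = 0}. E (- 1) (E 2 v) = 0}. E (- 2) (E 3 v) = 0}"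
  have "\<not> fin_dim scale V"
    unfolding V_def using fin inf
    by (intro infinite_dim_ker2[where x = "\<mu> - 1"] infinite_dim_ker[where x = "\<mu> - 1"]
        subspace_ker subspace_ker2 subspace_W) auto
  then obtain v where "v \<in> V" "v \<noteq> 0"
    by (rule infinite_dim_nonzero) (unfold V_def, intro subspace_ker subspace_ker2 subspace_W)
  then show ?thesis using that by (auto simp: V_def)
qed

text \<open>Reflection negates weights, so both \<mu> and -\<mu> lie in {0, 1}.\<close>

lemma weight_gap_zero:
  assumes fin: "fin_dim scale (W \<mu>)"
    and inf: "\<not> fin_dim scale (W (\<mu> - 1))" "\<not> fin_dim scale (W (\<mu> + 1))"
  shows "\<mu> = 0"
proof -
  interpret R: simple_virasoro_rep scale "\<lambda>i m. - E (- i) m" "- \<kappa>" by (rule reflected_simple)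
  have "\<mu> = 0 \<or> \<mu> = 1"
    using weight_gap_vector[OF fin inf(1)] weight_gap_zero_or_one inf(1) by metis
  moreover have R_inf: "\<not> fin_dim scale (R.W (- \<mu> - 1))" "fin_dim scale (R.W (- \<mu>))"
    using inf(2) fin by (simp_all add: weight_space_reflected add.commute)
  then have "- \<mu> = 0 \<or> - \<mu> = 1"
    using R.weight_gap_vector[OF R_inf(2,1)] R.weight_gap_zero_or_one by metis
  ultimately show ?thesis by auto
qed

text \<open>One vector for each nonzero integer weight already spans the module.\<close>

lemma weight_gap_at_zero_False:
  assumes fin: "fin_dim scale (W 0)" and inf: "\<not> fin_dim scale (W (- 1))"
  shows False
proof -
  interpret R: simple_virasoro_rep scale "\<lambda>i m. - E (- i) m" "- \<kappa>" by (rule reflected_simple)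
  obtain v where "v \<in> W (0 - 1)" and v: "v \<noteq> 0" "E 1 v = 0" "E (- 1) (E 2 v) = 0" "E (- 2) (E 3 v) = 0"
    using weight_gap_vector[OF fin] inf by auto
  then have v_W: "v \<in> W (- 1)" by simp
  define w where "w = E 2 v"
  have w_W: "w \<in> W 1" unfolding w_def using v_W by (rule E_in_W') simp
  have w_0: "w \<noteq> 0" unfolding w_def
    using fin_dim_of_highest_weight[OF v(1) v_W v(2)] inf by blast
  have Em2w_0: "E (- 2) w \<noteq> 0"
    using fin_dim_of_lowest_weight[OF w_0 w_W] v(3) inf by (auto simp: w_def)
  note str = E1_E[OF \<open>v \<in> W (0 - 1)\<close> v(2,3)] Em1_E[OF \<open>v \<in> W (0 - 1)\<close> v(2,3)]
    E2_E[OF \<open>v \<in> W (0 - 1)\<close> v(2,3)]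
  \<comment> \<open>The eigenvalue of e_2 e_{-2} on \<open>w\<close>: [e_2, e_{-2}] gives
    \<open>- 4 + \<kappa> / 2\<close> at weight 1, and e_{-2} e_2 w = e_{-2} e_4 v = 3 w adds
    3.\<close>
  define \<tau> where "\<tau> = \<kappa> / 2 - 1"
  have E1_Em2w: "E 1 (E (- 2) w) = 0"
    using commute[of 1 "- 2" w] str(1)[of 2] v(3,4) by (simp add: w_def)
  have "E (- 2) (E 4 v) = 3 *s w"
    using Em2_E[OF v_W v(2-4), of 4] by (simp add: w_def)
  moreover have "E 2 w = E 4 v" using str(3)[of 2] by (simp add: w_def)
  ultimately have "E 2 (E (- 2) w) - 3 *s w = - (4 *s w) + (\<kappa> / 2) *s w"
    using bracket[of 2 "- 2" w] w_W by (simp add: mem_W)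
  then have "E 2 (E (- 2) w) = - (4 *s w) + (\<kappa> / 2) *s w + 3 *s w"
    by (simp only: diff_eq_eq)
  also have "\<dots> = \<tau> *s w"
    by (simp add: \<tau>_def flip: scale_left_distrib scale_minus_left)
  finally have "E 2 (E (- 2) w) = \<tau> *s w" .
  \<comment> \<open>If nonzero, this difference would be a highest weight vector.\<close>
  then have "E 2 (E (- 2) w - \<tau> *s v) = 0" by (simp add: w_def)
  moreover have "E 1 (E (- 2) w - \<tau> *s v) = 0" using E1_Em2w v(2) by simp
  moreover have "E (- 2) w - \<tau> *s v \<in> W (- 1)"
    using v_W w_W by (intro subspace_diff subspace_scale subspace_W E_in_W'[of w 1]) auto
  ultimately have \<tau>: "E (- 2) w = \<tau> *s v"
    using fin_dim_of_highest_weight[of "E (- 2) w - \<tau> *s v" "- 1"] inf by auto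
  then have "\<tau> \<noteq> 0" using Em2w_0 by auto
  \<comment> \<open>Leads to the mirror image of \<open>E (- 2) (E 3 v) = 0\<close>, with
    \<open>w\<close> in place of \<open>v\<close>.\<close>
  have "E (- 3) w = - \<tau> *s E (- 1) v"
    using commute[of "- 1" "- 2" w] v(3) \<tau> by (simp add: w_def)
  moreover have "E 2 (E (- 1) v) = 0"
    using commute[of 2 "- 1" v] v(2,3) by simp
  ultimately have E2_Em3w: "E 2 (E (- 3) w) = 0" by simp

  \<comment> \<open>\<open>f n\<close> has weight \<open>n\<close>: the shifts offset the weights -1
    of \<open>v\<close> and 1 of \<open>w\<close>. Thus \<open>f 1 = w\<close> and
    \<open>f (- 1) = \<tau> *s v\<close>.\<close>
  define f where "f n = (if n > 0 then E (n + 1) v else E (n - 1) w)" for n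
  let ?N = "span (f ` {n. n \<noteq> 0})"
  have f_pos: "f n = E (n + 1) v" if "n > 0" for n using that by (simp add: f_def)
  have f_neg: "f n = E (n - 1) w" if "n < 0" for n using that by (simp add: f_def)
  have f_N: "f n \<in> ?N" if "n \<noteq> 0" for n using that by (simp add: span_base)
  have Ev: "E k v \<in> ?N" if "k \<ge> 2" for k
    using f_N[of "k - 1"] f_pos[of "k - 1"] that by simp
  have Ew: "E (- k) w \<in> ?N" if "k \<ge> 2" for k
    using f_N[of "- k + 1"] f_neg[of "- k + 1"] that by simp
  have w_N: "w \<in> ?N" unfolding w_def by (rule Ev) simp
  have "\<tau> *s v \<in> ?N" using Ew[of 2] \<tau> by simp
  then have "inverse \<tau> *s \<tau> *s v \<in> ?N" by (rule span_scale)
  then have v_N: "v \<in> ?N" using \<open>\<tau> \<noteq> 0\<close> by simp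
  have closed: "E j (f n) \<in> ?N" if j: "j \<in> {1, 2, - 1, - 2}" and n: "n \<noteq> 0" for j n
  proof (cases "n > 0")
    case True
    have "E (- 2) (E 2 v) \<in> ?N" using v_N \<tau> by (simp add: w_def span_scale)
    then show ?thesis
      using upper_half_closed[OF v_W v(2-4) _ _ Ev, of "n + 1" j] True j f_pos[OF True] by simp
  next
    case False
    \<comment> \<open>In the reflected module \<open>w\<close> has weight -1 and takes the role of
      \<open>v\<close>.\<close>
    have "- E (- (- j)) (- E (- (1 - n)) w) \<in> ?N"
    proof (rule R.upper_half_closed)
      show "w \<in> R.W (- 1)" using w_W by (simp add: weight_space_reflected)
      show "- E (- 1) w = 0" using v(3) by (simp add: w_def)
      show "- E (- (- 1)) (- E (- 2) w) = 0" using E1_Em2w by simp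
      show "- E (- (- 2)) (- E (- 3) w) = 0" using E2_Em3w by simp
      show "- E (- (- 2)) (- E (- 2) w) \<in> ?N" using \<tau> w_N by (simp add: span_scale w_def)
      show "- E (- k) w \<in> ?N" if "k \<ge> 2" for k using Ew[OF that] by (rule span_neg)
      show "1 - n \<ge> 2" using False n by simp
      show "- j \<in> {1, 2, - 1, - 2}" using j by auto
    qed simp
    then show ?thesis using False n f_neg[of n] by simp
  qed
  have "E j m \<in> ?N" if m: "m \<in> ?N" and j: "j \<in> {1, 2, - 1, - 2}" for j m
    using m
  proof (rule span_induct)
    show "subspace {m. E j m \<in> ?N}"
      by (rule subspaceI) (auto intro: span_zero span_add span_scale)
  qed (use closed j in auto)
  then have "E k m \<in> ?N" if "m \<in> ?N" for k m
    using closed_all[OF subspace_span _ _ _ _ that] by simp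
  then have "?N = UNIV"
    using irreducible[of ?N] v(1) v_N by auto
  moreover have "f n \<in> W (of_int n)" for n
    unfolding f_def using v_W w_W by (auto intro: E_in_W')
  moreover have "finite {n \<in> {n. n \<noteq> 0}. of_int n = (x :: 'a)}" for x
  proof (rule finite_subset)
    show "{n \<in> {n. n \<noteq> 0}. of_int n = x} \<subseteq> {THE n. of_int n = x}"
      by (auto intro!: the_equality[symmetric])
  qed simp
  ultimately have "fin_dim scale (W x)" for x
    by (intro fin_dim_weight_spaceI[of "{n. n \<noteq> 0}" f of_int]) auto
  then show False using inf by blast
qed

section \<open>All weight spaces of a coset\<close>

text \<open>A finite dimensional weight space in the coset is not isolated, so there are two, and
  two force finite dimension along the whole coset, including \<open>x\<close>.\<close>

lemma infinite_dim_all: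
  assumes inf: "\<not> fin_dim scale (W x)"
  shows "\<not> fin_dim scale (W (x + of_int k))"
proof
  assume fin_k: "fin_dim scale (W (x + of_int k))"
  define F where "F n \<longleftrightarrow> fin_dim scale (W (x + of_int n))" for n
  have above: "F n" if "F (n + 1)" "F j" "j \<ge> n + 2" for n j
    using fin_dim_if_two_above[of "x + of_int n" "j - n"] that by (simp add: F_def add.assoc)
  have below: "F n" if "F (n - 1)" "F j" "j \<le> n - 2" for n j
    using fin_dim_if_two_below[of "x + of_int n" "n - j"] that by (simp add: F_def algebra_simps)
  have isolated: False if "F n" "\<not> F (n - 1)" "\<not> F (n + 1)" for n
    using that weight_gap_zero[of "x + of_int n"] weight_gap_at_zero_False
    by (simp add: F_def algebra_simps)
  have down: "F n" if "F i" "F j" "i < j" "n \<le> i" for i j n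
    using that(4)
  proof (induction n rule: int_le_induct)
    case (step n)
    then show ?case using above[of "n - 1" j] that by simp
  qed (use that in simp)
  have up: "F n" if "F i" "F j" "i < j" "n \<ge> j" for i j n
    using that(4)
  proof (induction n rule: int_ge_induct)
    case (step n)
    then show ?case using below[of "n + 1" i] that by simp
  qed (use that in simp)
  have "F k" "\<not> F 0" using fin_k inf by (simp_all add: F_def)
  moreover obtain j where "F j" "j \<noteq> k"
    using isolated[OF \<open>F k\<close>] by (metis add_cancel_left_right diff_add_cancel zero_neq_one)
  ultimately obtain i j where ij: "F i" "F j" "i < j" by (metis linorder_neqE)
  \<comment> \<open>Weights between \<open>i\<close> and \<open>j\<close> are reached by going down
    to \<open>i - 1\<close> and then up from the adjacent pair \<open>i - 1\<close>,
    \<open>i\<close>.\<close>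
  have "F 0"
    using down[OF ij, of 0] up[of "i - 1" i 0] down[OF ij, of "i - 1"] ij(1) by linarith
  then show False using \<open>\<not> F 0\<close> by simp
qed

end

section \<open>Passage to the locale, and the support\<close>

theorem theorem1:
  fixes scale :: "'k::field_char_0 \<Rightarrow> 'm::ab_group_add \<Rightarrow> 'm"
    and E :: "int \<Rightarrow> 'm \<Rightarrow> 'm" and C :: "'m \<Rightarrow> 'm" and w :: 'k
  assumes "alg_closed TYPE('k)"
    and "vir_weight_module scale E C"
    and "vir_simple scale E C"
    and "\<not> fin_dim scale (weight_space scale E w)"
  shows "supp scale E = {w + of_int k | k. True} \<and>
         (\<forall>k::int. \<not> fin_dim scale (weight_space scale E (w + of_int k)))"
proof -
  have mod: "vir_module scale E C" and nz: "\<exists>m::'m. m \<noteq> 0"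
    and irr: "\<And>N. vir_submodule scale E C N \<Longrightarrow> N = {0} \<or> N = UNIV"
    using assms(3) unfolding vir_simple_def by auto
  interpret vector_space scale using mod unfolding vir_module_def by simp
  interpret C: Vector_Spaces.linear scale scale C using mod unfolding vir_module_def by simp
  have lin: "Vector_Spaces.linear scale scale (E i)" for i using mod unfolding vir_module_def by simp
  have CE: "C (E i m) = E i (C m)" for i m using mod unfolding vir_module_def by simp
  have E_scale: "E i (scale a m) = scale a (E i m)" for i a m
    using lin by (simp add: Vector_Spaces.linear_iff)

  obtain \<kappa> where C_scalar: "C m = scale \<kappa> m" for m
  proof -
    have "\<not> {m. \<exists>\<mu>. C m = scale \<mu> m} \<subseteq> {0}"
      using assms(2) nz span_mono[of "{m. \<exists>\<mu>. C m = scale \<mu> m}" "{0}"]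
      unfolding vir_weight_module_def by auto
    then obtain u \<kappa> where u: "u \<noteq> 0" "C u = scale \<kappa> u" by auto
    have "vir_submodule scale E C {m. C m = scale \<kappa> m}"
      unfolding vir_submodule_def
      by (auto intro!: subspaceI simp: C.add C.scale C.zero scale_right_distrib mult.commute CE E_scale)
    then have "{m. C m = scale \<kappa> m} = UNIV" using irr u by auto
    then show ?thesis using that by auto
  qed
  have irr': "N = {0} \<or> N = UNIV" if "subspace N" "\<And>i m. m \<in> N \<Longrightarrow> E i m \<in> N" for N
    using irr[of N] that subspace_scale[OF that(1)] by (auto simp: vir_submodule_def C_scalar)
  have br: "E i (E j m) - E j (E i m) = scale (of_int (j - i)) (E (i + j) m) +
      (if i = - j then scale (of_int (i ^ 3 - i) / 12 * \<kappa>) m else 0)" for i j m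
    using mod unfolding vir_module_def by (simp add: C_scalar)
  interpret simple_virasoro_rep scale E \<kappa>
    by (intro simple_virasoro_rep.intro virasoro_rep.intro virasoro_rep_axioms.intro
        simple_virasoro_rep_axioms.intro vector_space_axioms lin br irr')

  have inf: "\<not> fin_dim scale (W (w + of_int k))" for k
    using infinite_dim_all[OF assms(4)] .
  have "w + of_int k \<in> supp scale E" for k
    using infinite_dim_nonzero[OF inf subspace_W] unfolding supp_def mem_W by blast
  moreover have "\<exists>k. x = w + of_int k" if x: "x \<in> supp scale E" for x
  proof (rule ccontr)
    assume no: "\<nexists>k. x = w + of_int k"
    \<comment> \<open>\<open>?N\<close> is the sum of the weight spaces of the coset, a nonzero
      submodule and hence everything. Pairing a vector with its offset makes the weight a function
      of the index; no index has weight \<open>x\<close>, so \<open>W x\<close> is zero.\<close>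
    define I where "I = {p :: 'm \<times> int. fst p \<in> W (w + of_int (snd p))}"
    let ?N = "span (fst ` I)"
    have "E i m \<in> ?N" if "m \<in> ?N" for i m
      using that
    proof (rule span_induct)
      show "subspace {m. E i m \<in> ?N}"
        by (rule subspaceI) (auto intro: span_zero span_add span_scale)
      fix m assume "m \<in> fst ` I"
      then obtain k where "m \<in> W (w + of_int k)" by (auto simp: I_def)
      then have "E i m \<in> W (w + of_int (k + i))" by (rule E_in_W') simp
      then have "(E i m, k + i) \<in> I" by (simp add: I_def)
      then show "E i m \<in> ?N" by (metis fst_conv imageI span_base)
    qed
    then have "?N = {0} \<or> ?N = UNIV" by (intro irreducible subspace_span)
    moreover obtain v where "v \<in> W (w + of_int 0)" "v \<noteq> 0"
      using infinite_dim_nonzero[OF inf subspace_W] .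
    then have "(v, 0) \<in> I" "v \<noteq> 0" by (auto simp: I_def)
    then have "v \<in> ?N" "v \<noteq> 0" by (metis fst_conv imageI span_base)+
    ultimately have "?N = UNIV" by auto
    then have "W x \<subseteq> span (fst ` {p \<in> I. w + of_int (snd p) = x})"
      by (intro weight_space_subset_span) (auto simp: I_def)
    also have "{p \<in> I. w + of_int (snd p) = x} = {}" using no by auto
    finally show False using x by (auto simp: supp_def mem_W)
  qed
  ultimately show ?thesis using inf by auto
qed

end
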